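(* Let $\phi_1,\phi_2\in\Phi_0$ be lower-semicontinuous with $\mathrm{dom}(\phi_1^* )=\mathrm{dom}(\phi_2^* )=\mathbb{R}$, and assume that $\phi_1^*(s)>s$ and $\phi_2^*(s)>s$ for all $s\neq0$. For any $x\in\mathbb{R}$ and $p\in(0,1)$ let $X_p$ be a random variable which under $\mathbb{P}$ equals $x$ with probability $p$ and $0$ with probability $1-p$. Then for every $x\in\mathbb{R}$ $$\lim_{p\downarrow 0}\frac{\rho^l_{\mathrm{oce},\mathbb{P}}(X_p)}{p}=\phi_2^*(\phi_1^*(-x)).$$ If, in addition, $\phi_2^*\circ\phi_1^*$ is differentiable at zero with derivative $(\phi_2^*\circ\phi_1^* )'(0)=1$, then also $$\lim_{p\downarrow 0}\frac{\rho^l_{\mathrm{sf},\mathbb{P}}(X_p)}{p}=\phi_2^*(\phi_1^*(-x)).$$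
   Context: $\Phi_0$ is the set of all convex functions $\phi:\mathbb{R}\to[0,\infty]$ with $\phi(1)=0$ whose effective domain $\{t:\phi(t)<\infty\}$ is contained in $[0,\infty)$ and contains a neighborhood of $1$. $\phi^*(s)=\sup_{t\in\mathbb{R}}\{st-\phi(t)\}$ is the convex conjugate and $\mathrm{dom}(\phi^* )=\{s:\phi^*(s)<\infty\}$. The robust OCE risk measure (given by its dual formulation) is $$\rho^{l}_{\mathrm{oce},\mathbb{P}}(X)=\inf_{\theta_1,\theta_2\in \mathbb{R}}\left\{-\theta_1-\theta_2+\mathbb{E}_{\mathbb{P}}\left[\phi_2^*(\phi_1^*(\theta_2-X)+\theta_1)\right]\right\}.$$ The robust shortfall risk measure (given by its dual formulation) is, with $u(y)=-\phi_1^*(-y)$, $$\rho^l_{\mathrm{sf},\mathbb{P}}(X)=\inf_{\theta_1,\theta_2\in \mathbb{R}}\left\{\theta_2\ \middle|\ \mathbb{E}_{\mathbb{P}}[\phi_2^*(\theta_1-u(X+\theta_2))]\leq \theta_1\right\}=\inf_{\theta_1,\theta_2\in \mathbb{R}}\left\{\theta_2\ \middle|\ \mathbb{E}_{\mathbb{P}}[\phi_2^*(\phi_1^*(-\theta_2-X)+\theta_1)]\leq \theta_1\right\}.$$ *)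

theory Defs
  imports "HOL-Probability.Probability"
begin

definition eff_dom :: "(real \<Rightarrow> ereal) \<Rightarrow> real set" where
  "eff_dom f = {t. f t < \<infinity>}"

text \<open>For functions with values in \<open>[0,\<infinity>]\<close>, so the right-hand side never has the form \<open>\<infinity> - \<infinity>\<close>.\<close>

definition ereal_convex :: "(real \<Rightarrow> ereal) \<Rightarrow> bool" where
  "ereal_convex f \<longleftrightarrow>
     (\<forall>a b u v. 0 \<le> u \<longrightarrow> 0 \<le> v \<longrightarrow> u + v = 1 \<longrightarrow>
        f (u * a + v * b) \<le> ereal u * f a + ereal v * f b)"

definition lower_semicontinuous :: "(real \<Rightarrow> ereal) \<Rightarrow> bool" where
  "lower_semicontinuous f \<longleftrightarrow> (\<forall>t. f t \<le> Liminf (at t) f)"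

definition Phi0 :: "(real \<Rightarrow> ereal) set" where
  "Phi0 = {\<phi>. (\<forall>t. 0 \<le> \<phi> t) \<and> ereal_convex \<phi> \<and> \<phi> 1 = 0 \<and>
              eff_dom \<phi> \<subseteq> {0..} \<and> 1 \<in> interior (eff_dom \<phi>)}"

text \<open>
  The argument is extended real so that conjugates compose. For \<open>\<phi> \<in> Phi0\<close> the formula gives
  the usual value \<open>\<infinity>\<close> at \<open>s = \<infinity>\<close> (take \<open>t = 1\<close>), and the conjugate never takes the
  value \<open>-\<infinity>\<close> at a real argument, so \<open>s = -\<infinity>\<close> does not arise in compositions.
\<close>

definition conv_conj :: "(real \<Rightarrow> ereal) \<Rightarrow> ereal \<Rightarrow> ereal" where
  "conv_conj \<phi> s = (SUP t::real. s * ereal t - \<phi> t)"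

text \<open>
  Integral of the positive part minus integral of the negative part; \<open>\<infinity> - \<infinity> = \<infinity>\<close> in
  \<^typ>\<open>ereal\<close>, so a random variable without a well-defined expectation gets the value \<open>\<infinity>\<close>.
\<close>

definition ereal_expectation :: "'a measure \<Rightarrow> ('a \<Rightarrow> ereal) \<Rightarrow> ereal" where
  "ereal_expectation M Y =
     enn2ereal (\<integral>\<^sup>+ \<omega>. e2ennreal (Y \<omega>) \<partial>M) - enn2ereal (\<integral>\<^sup>+ \<omega>. e2ennreal (- Y \<omega>) \<partial>M)"

definition rho_oce ::
  "(real \<Rightarrow> ereal) \<Rightarrow> (real \<Rightarrow> ereal) \<Rightarrow> 'a measure \<Rightarrow> ('a \<Rightarrow> real) \<Rightarrow> ereal" where
  "rho_oce \<phi>1 \<phi>2 M X =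
     Inf {ereal (- \<theta>1 - \<theta>2) +
            ereal_expectation M (\<lambda>\<omega>. conv_conj \<phi>2 (conv_conj \<phi>1 (ereal (\<theta>2 - X \<omega>)) + ereal \<theta>1))
          | \<theta>1 \<theta>2 :: real. True}"

definition rho_sf ::
  "(real \<Rightarrow> ereal) \<Rightarrow> (real \<Rightarrow> ereal) \<Rightarrow> 'a measure \<Rightarrow> ('a \<Rightarrow> real) \<Rightarrow> ereal" where
  "rho_sf \<phi>1 \<phi>2 M X =
     Inf {ereal \<theta>2 | \<theta>1 \<theta>2 :: real.
            ereal_expectation M (\<lambda>\<omega>. conv_conj \<phi>2 (conv_conj \<phi>1 (ereal (- \<theta>2 - X \<omega>)) + ereal \<theta>1))
              \<le> ereal \<theta>1}"

end

theory Submission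
  imports Defs
begin

text \<open>
  Write \<open>f\<close> and \<open>g\<close> for the two conjugates. They are real-valued, convex, nondecreasing, vanish at
  \<open>0\<close> and lie strictly above the diagonal elsewhere. With \<open>w = f \<theta>2 + \<theta>1\<close> the OCE objective is
  \<open>(1 - p) * ((g w - w) + (f \<theta>2 - \<theta>2)) + p * L\<close>, where \<open>L\<close> is bounded below by \<open>-x\<close> and equals
  \<open>g (f (-x))\<close> at the origin. By convexity the first bracket is bounded away from \<open>0\<close> outside every
  neighbourhood of the origin, so for small \<open>p\<close> only parameters near the origin matter, and there
  continuity of \<open>L\<close> gives the lower bound. The choice \<open>\<theta>1 = \<theta>2 = 0\<close> gives the upper bound.
  Any \<open>\<theta>2\<close> admissible for the shortfall problem dominates an OCE objective value, so the lower
  bound carries over; for the upper bound, \<open>\<theta>1 = 0\<close> and \<open>\<theta>2 = p * (g (f (-x)) + \<epsilon>)\<close> is admissible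
  for small \<open>p\<close> because \<open>g \<circ> f\<close> has slope \<open>1\<close> at the origin.
\<close>

section \<open>Conjugates as real-valued functions\<close>

lemma conv_conj_ge:
  assumes "\<phi> t = ereal c"
  shows "ereal (s * t - c) \<le> conv_conj \<phi> (ereal s)"
proof -
  have "ereal s * ereal t - \<phi> t \<le> conv_conj \<phi> (ereal s)"
    unfolding conv_conj_def by (rule SUP_upper) simp
  with assms show ?thesis by simp
qed

lemma conv_conj_le:
  assumes "\<And>t. 0 \<le> \<phi> t" and "\<And>t c. \<phi> t = ereal c \<Longrightarrow> s * t - c \<le> B"
  shows "conv_conj \<phi> (ereal s) \<le> ereal B"
  unfolding conv_conj_def
proof (rule SUP_least)
  fix t
  show "ereal s * ereal t - \<phi> t \<le> ereal B"
    using assms(1)[of t] assms(2)[of t] by (cases "\<phi> t") auto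
qed

text \<open>These four properties are all that the estimates below use of a conjugate.\<close>

locale conjugate_like =
  fixes f :: "real \<Rightarrow> real"
  assumes convex: "convex_on UNIV f"
    and mono: "mono f"
    and zero: "f 0 = 0"
    and above_diagonal: "s \<noteq> 0 \<Longrightarrow> s < f s"
begin

lemma ge_diagonal: "s \<le> f s"
  using above_diagonal[of s] zero by (cases "s = 0") auto

lemma continuous: "continuous_on UNIV f"
  by (rule convex_on_continuous[OF open_UNIV convex])

lemma isCont: "isCont f s"
  using continuous by (simp add: continuous_on_eq_continuous_at)

text \<open>The gap \<open>f s - s\<close> is convex, nonnegative and zero at the origin, so scaling
  the argument towards the origin cannot increase it.\<close>

lemma gap_shrink:
  assumes "0 \<le> u" "u \<le> 1"
  shows "f (u * s) - u * s \<le> f s - s"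
proof -
  have "f ((1 - u) *\<^sub>R 0 + u *\<^sub>R s) \<le> (1 - u) * f 0 + u * f s"
    by (rule convex_onD[OF convex]) (use assms in auto)
  then have "f (u * s) - u * s \<le> u * (f s - s)"
    by (simp add: zero algebra_simps)
  also have "\<dots> \<le> 1 * (f s - s)"
    by (rule mult_right_mono) (use assms ge_diagonal[of s] in auto)
  finally show ?thesis by simp
qed

lemma gap_bounded_away:
  assumes "0 < \<delta>"
  obtains m where "0 < m" and "\<And>s. \<delta> \<le> \<bar>s\<bar> \<Longrightarrow> m \<le> f s - s"
proof
  let ?m = "min (f \<delta> - \<delta>) (f (- \<delta>) + \<delta>)"
  show "0 < ?m"
    using above_diagonal[of \<delta>] above_diagonal[of "- \<delta>"] assms by simp
  fix s :: real assume s: "\<delta> \<le> \<bar>s\<bar>"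
  \<comment> \<open>Any such \<open>s\<close> is scaled down to one of the two points \<delta> and
    -\<delta>, so the smaller of their two gaps is a uniform bound.\<close>
  have "f (\<delta> / \<bar>s\<bar> * s) - \<delta> / \<bar>s\<bar> * s \<le> f s - s"
    by (rule gap_shrink) (use assms s in auto)
  moreover have "\<delta> / \<bar>s\<bar> * s = \<delta> \<or> \<delta> / \<bar>s\<bar> * s = - \<delta>"
    using assms s by (cases "0 < s") auto
  ultimately show "?m \<le> f s - s" by auto
qed

end

text \<open>The point \<open>t = 1\<close>, where \<phi> vanishes, bounds the conjugate below by the
  identity, and the domain assumption excludes \<infinity>. A supremum of affine functions is
  convex; it is nondecreasing because the slopes \<open>t\<close> with finite \<phi> are
  nonnegative.\<close>

lemma conjugate_like_conv_conj:
  assumes \<phi>: "\<phi> \<in> Phi0"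
    and dom: "eff_dom (\<lambda>s. conv_conj \<phi> (ereal s)) = UNIV"
    and diag: "\<And>s::real. s \<noteq> 0 \<Longrightarrow> ereal s < conv_conj \<phi> (ereal s)"
  obtains f where "conjugate_like f" and "\<And>s. conv_conj \<phi> (ereal s) = ereal (f s)"
proof -
  have nonneg: "\<And>t. 0 \<le> \<phi> t" and one: "\<phi> 1 = ereal 0" and supp: "\<And>t. \<phi> t < \<infinity> \<Longrightarrow> 0 \<le> t"
    using \<phi> by (auto simp: Phi0_def eff_dom_def zero_ereal_def)
  have below: "conv_conj \<phi> (ereal s) < \<infinity>" for s
    using dom by (auto simp: eff_dom_def)
  have "ereal s \<le> conv_conj \<phi> (ereal s)" for s
    using conv_conj_ge[of \<phi> 1 0 s, OF one] by simp
  with below have finite: "\<bar>conv_conj \<phi> (ereal s)\<bar> \<noteq> \<infinity>" for s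
    by (metis ereal_infty_less_eq(2) ereal_infinity_cases less_irrefl MInfty_neq_ereal(2))
  define f where "f s = real_of_ereal (conv_conj \<phi> (ereal s))" for s
  have f: "conv_conj \<phi> (ereal s) = ereal (f s)" for s
    unfolding f_def using finite[of s] by (simp add: ereal_real')
  have ge: "s * t - c \<le> f s" if "\<phi> t = ereal c" for s t c
    using conv_conj_ge[of \<phi> t c s] that by (simp add: f)
  have le: "f s \<le> B" if "\<And>t c. \<phi> t = ereal c \<Longrightarrow> s * t - c \<le> B" for s B
    using conv_conj_le[of \<phi> s B] that nonneg by (simp add: f)
  have "conjugate_like f"
  proof
    show "convex_on UNIV f"
    proof (rule convex_onI)
      fix u a b :: real assume u: "0 < u" "u < 1"
      show "f ((1 - u) *\<^sub>R a + u *\<^sub>R b) \<le> (1 - u) * f a + u * f b"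
      proof (rule le)
        fix t c assume t: "\<phi> t = ereal c"
        have "(1 - u) * (a * t - c) + u * (b * t - c) \<le> (1 - u) * f a + u * f b"
          using u by (intro add_mono mult_left_mono ge[OF t]) auto
        then show "((1 - u) *\<^sub>R a + u *\<^sub>R b) * t - c \<le> (1 - u) * f a + u * f b"
          by (simp add: algebra_simps)
      qed
    qed simp
    show "mono f"
    proof (rule monoI, rule le)
      fix a b t c :: real assume "a \<le> b" and t: "\<phi> t = ereal c"
      then have "a * t \<le> b * t"
        using supp[of t] by (intro mult_right_mono) auto
      with ge[OF t, of b] show "a * t - c \<le> f b" by simp
    qed
    show "f 0 = 0"
    proof (rule antisym)
      show "f 0 \<le> 0"
        by (rule le) (metis nonneg ereal_less_eq(5) diff_0 mult_zero_left neg_le_0_iff_le)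
      show "0 \<le> f 0" using ge[OF one, of 0] by simp
    qed
    show "s < f s" if "s \<noteq> 0" for s
      using diag[OF that] by (simp add: f)
  qed
  with f show ?thesis using that by blast
qed

section \<open>Two-point expectations and a criterion for the limit\<close>

lemma ereal_expectation_two_point:
  fixes h :: "real \<Rightarrow> real"
  assumes p: "p \<in> {0<..<1}" and h: "h \<in> borel_measurable borel"
    and X: "X \<in> borel_measurable M"
    and D: "distr M borel X = distr (measure_pmf (bernoulli_pmf p)) borel (\<lambda>b. if b then x else 0)"
  shows "ereal_expectation M (\<lambda>\<omega>. ereal (h (X \<omega>))) = ereal (p * h x + (1 - p) * h 0)"
proof -
  \<comment> \<open>Since \<open>ennreal\<close> sends negative numbers to 0, this identity gives
    the positive part for \<open>k = h\<close> and the negative part for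
    \<open>k = - h\<close>.\<close>
  have int: "(\<integral>\<^sup>+ \<omega>. ennreal (k (X \<omega>)) \<partial>M) = ennreal (p * max 0 (k x) + (1 - p) * max 0 (k 0))"
    if k: "k \<in> borel_measurable borel" for k :: "real \<Rightarrow> real"
  proof -
    have "(\<integral>\<^sup>+ \<omega>. ennreal (k (X \<omega>)) \<partial>M) = (\<integral>\<^sup>+ y. ennreal (k y) \<partial>distr M borel X)"
      using k X by (simp add: nn_integral_distr)
    also have "\<dots> = (\<integral>\<^sup>+ b. ennreal (k (if b then x else 0)) \<partial>measure_pmf (bernoulli_pmf p))"
      unfolding D using k by (simp add: nn_integral_distr)
    also have "\<dots> = ennreal p * ennreal (k x) + ennreal (1 - p) * ennreal (k 0)"
      using p by (simp add: nn_integral_measure_pmf nn_integral_count_space_finite UNIV_bool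
          mult.commute)
    also have "\<dots> = ennreal p * ennreal (max 0 (k x)) + ennreal (1 - p) * ennreal (max 0 (k 0))"
      by (simp add: max_def ennreal_neg)
    also have "\<dots> = ennreal (p * max 0 (k x) + (1 - p) * max 0 (k 0))"
      using p by (simp add: ennreal_mult' ennreal_plus)
    finally show ?thesis .
  qed
  have neg: "(\<lambda>y. - h y) \<in> borel_measurable borel" using h by simp
  have "ereal_expectation M (\<lambda>\<omega>. ereal (h (X \<omega>))) =
      ereal ((p * max 0 (h x) + (1 - p) * max 0 (h 0)) -
             (p * max 0 (- h x) + (1 - p) * max 0 (- h 0)))"
    unfolding ereal_expectation_def using int[OF h] int[OF neg] p
    by (simp add: e2ennreal_ereal enn2ereal_ennreal del: ennreal_plus)
  also have "(p * max 0 (h x) + (1 - p) * max 0 (h 0)) -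
      (p * max 0 (- h x) + (1 - p) * max 0 (- h 0)) = p * h x + (1 - p) * h 0"
    by (auto simp: max_def algebra_simps)
  finally show ?thesis .
qed

text \<open>With the bounds multiplied out by \<open>p\<close>, extended-real infima can be inserted
  without a separate proof that they are finite.\<close>

lemma tendsto_ereal_divide_at_right_0I:
  fixes R :: "real \<Rightarrow> ereal"
  assumes lower: "\<And>\<epsilon>. 0 < \<epsilon> \<Longrightarrow> \<forall>\<^sub>F p in at_right 0. ereal (p * (A - \<epsilon>)) \<le> R p"
    and upper: "\<And>\<epsilon>. 0 < \<epsilon> \<Longrightarrow> \<forall>\<^sub>F p in at_right 0. R p \<le> ereal (p * (A + \<epsilon>))"
  shows "((\<lambda>p. R p / ereal p) \<longlongrightarrow> ereal A) (at_right 0)"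
proof (rule order_tendstoI)
  have pos: "\<forall>\<^sub>F p in at_right 0. 0 < (p::real)"
    by (rule eventually_at_right_less)
  fix a assume "a < ereal A"
  then obtain r where r: "a < ereal r" "r < A"
    using ereal_dense2[of a "ereal A"] by auto
  have "\<forall>\<^sub>F p in at_right 0. ereal (p * r) \<le> R p"
    using lower[of "A - r"] r by simp
  with pos show "\<forall>\<^sub>F p in at_right 0. a < R p / ereal p"
  proof eventually_elim
    case (elim p)
    then have "ereal r \<le> R p / ereal p"
      by (simp add: ereal_le_divide_pos)
    with r show ?case by simp
  qed
next
  have pos: "\<forall>\<^sub>F p in at_right 0. 0 < (p::real)"
    by (rule eventually_at_right_less)
  fix a assume "ereal A < a"
  then obtain r where r: "ereal r < a" "A < r"
    using ereal_dense2[of "ereal A" a] by auto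
  have "\<forall>\<^sub>F p in at_right 0. R p \<le> ereal (p * r)"
    using upper[of "r - A"] r by simp
  with pos show "\<forall>\<^sub>F p in at_right 0. R p / ereal p < a"
  proof eventually_elim
    case (elim p)
    then have "R p / ereal p \<le> ereal r"
      by (simp add: ereal_divide_le_pos)
    with r show ?case by simp
  qed
qed

section \<open>Estimates for the OCE objective and the shortfall constraint\<close>

locale conjugate_pair = F: conjugate_like f + G: conjugate_like g
  for f g :: "real \<Rightarrow> real"
begin

text \<open>The expectation in both risk measures: \<open>s\<close> is \<theta>2 for the OCE and
  -\<theta>2 for the shortfall.\<close>

definition mean :: "real \<Rightarrow> real \<Rightarrow> real \<Rightarrow> real \<Rightarrow> real" where
  "mean x p \<theta>1 s = p * g (f (s - x) + \<theta>1) + (1 - p) * g (f s + \<theta>1)"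

lemma objective_far:
  assumes p: "0 < p" "p < 1" and gap: "m \<le> (g (f s + \<theta>1) - (f s + \<theta>1)) + (f s - s)"
  shows "(1 - p) * m - p * x \<le> - \<theta>1 - s + mean x p \<theta>1 s"
proof -
  \<comment> \<open>Whatever the parameters, the outcome \<open>x\<close> contributes at least
    \<open>- x\<close>, by the diagonal bound for \<open>g\<close> and then for
    \<open>f\<close>.\<close>
  have "- x \<le> g (f (s - x) + \<theta>1) - \<theta>1 - s"
    using G.ge_diagonal[of "f (s - x) + \<theta>1"] F.ge_diagonal[of "s - x"] by linarith
  then have "p * (- x) \<le> p * (g (f (s - x) + \<theta>1) - \<theta>1 - s)"
    using p by (intro mult_left_mono) auto
  moreover have "(1 - p) * m \<le> (1 - p) * ((g (f s + \<theta>1) - (f s + \<theta>1)) + (f s - s))"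
    using p gap by (intro mult_left_mono) auto
  ultimately show ?thesis
    by (simp add: mean_def algebra_simps)
qed

lemma objective_near:
  assumes p: "0 < p" "p < 1" and near: "\<bar>s\<bar> < \<delta>" "\<bar>f s + \<theta>1\<bar> < \<delta>"
  shows "p * (g (f (- \<delta> - x) - f \<delta> - \<delta>) - \<delta>) \<le> - \<theta>1 - s + mean x p \<theta>1 s"
proof -
  have "f (- \<delta> - x) \<le> f (s - x)" "f s \<le> f \<delta>"
    using near by (auto intro!: monoD[OF F.mono])
  \<comment> \<open>Nearness of \<open>f s + \<theta>1\<close> to 0 together with
    \<open>f s \<le> f \<delta>\<close> keeps \<theta>1 above
    \<open>- f \<delta> - \<delta>\<close>.\<close>
  then have "f (- \<delta> - x) - f \<delta> - \<delta> \<le> f (s - x) + \<theta>1"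
    using near by linarith
  then have "g (f (- \<delta> - x) - f \<delta> - \<delta>) \<le> g (f (s - x) + \<theta>1)"
    by (rule monoD[OF G.mono])
  moreover have "- \<delta> \<le> - \<theta>1 - s"
    using near F.ge_diagonal[of s] by linarith
  ultimately have "p * (g (f (- \<delta> - x) - f \<delta> - \<delta>) - \<delta>) \<le> p * (g (f (s - x) + \<theta>1) - \<theta>1 - s)"
    using p by (intro mult_left_mono) auto
  moreover have "0 \<le> (1 - p) * (g (f s + \<theta>1) - \<theta>1 - s)"
    using p G.ge_diagonal[of "f s + \<theta>1"] F.ge_diagonal[of s] by (intro mult_nonneg_nonneg) auto
  ultimately show ?thesis
    by (simp add: mean_def algebra_simps)
qed

text \<open>The threshold for \<open>p\<close> must serve all parameters at once, since an infimum
  over them is taken later. Hence \<delta> is fixed first, and the gap bound \<open>m\<close>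
  depends on \<delta> alone.\<close>

lemma objective_lower_bound:
  assumes "0 < \<epsilon>"
  shows "\<forall>\<^sub>F p in at_right 0. \<forall>\<theta>1 s. p * (g (f (- x)) - \<epsilon>) \<le> - \<theta>1 - s + mean x p \<theta>1 s"
proof -
  let ?A = "g (f (- x))"
  have "isCont (\<lambda>\<delta>. g (f (- \<delta> - x) - f \<delta> - \<delta>) - \<delta>) 0"
    by (intro continuous_intros isCont_o2[OF _ G.isCont] isCont_o2[OF _ F.isCont])
  then have "((\<lambda>\<delta>. g (f (- \<delta> - x) - f \<delta> - \<delta>) - \<delta>) \<longlongrightarrow> ?A) (at_right 0)"
    by (auto simp: isCont_def F.zero intro: filterlim_mono[OF _ order.refl at_le])
  then have "\<forall>\<^sub>F \<delta> in at_right 0. ?A - \<epsilon> < g (f (- \<delta> - x) - f \<delta> - \<delta>) - \<delta>"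
    by (rule order_tendstoD) (use assms in simp)
  then have "\<forall>\<^sub>F \<delta> in at_right 0. 0 < \<delta> \<and> ?A - \<epsilon> < g (f (- \<delta> - x) - f \<delta> - \<delta>) - \<delta>"
    by (rule eventually_conj[OF eventually_at_right_less])
  then obtain \<delta> where \<delta>: "0 < \<delta>" "?A - \<epsilon> < g (f (- \<delta> - x) - f \<delta> - \<delta>) - \<delta>"
    using eventually_happens'[OF trivial_limit_at_right_real] by blast
  obtain m1 where m1: "0 < m1" "\<And>s. \<delta> \<le> \<bar>s\<bar> \<Longrightarrow> m1 \<le> f s - s"
    using F.gap_bounded_away[OF \<delta>(1)] by blast
  obtain m2 where m2: "0 < m2" "\<And>s. \<delta> \<le> \<bar>s\<bar> \<Longrightarrow> m2 \<le> g s - s"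
    using G.gap_bounded_away[OF \<delta>(1)] by blast
  define m where "m = min m1 m2"
  \<comment> \<open>The far bound tends to \<open>m > 0\<close>, whereas the target
    \<open>p * (?A - \<epsilon>)\<close> tends to 0.\<close>
  have "((\<lambda>p. (1 - p) * m - p * x - p * (?A - \<epsilon>)) \<longlongrightarrow> (1 - 0) * m - 0 * x - 0 * (?A - \<epsilon>)) (at_right 0)"
    by (intro tendsto_intros)
  then have "\<forall>\<^sub>F p in at_right 0. 0 < (1 - p) * m - p * x - p * (?A - \<epsilon>)"
    by (rule order_tendstoD) (use m1 m2 in \<open>simp add: m_def\<close>)
  moreover have "\<forall>\<^sub>F p in at_right (0::real). p \<in> {0<..<1}"
    by (rule eventually_at_right_real) simp
  ultimately show ?thesis
  proof eventually_elim
    case (elim p)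
    then have p: "0 < p" "p < 1" by auto
    show ?case
    proof (intro allI)
      fix \<theta>1 s
      show "p * (?A - \<epsilon>) \<le> - \<theta>1 - s + mean x p \<theta>1 s"
      proof (cases "\<bar>s\<bar> < \<delta> \<and> \<bar>f s + \<theta>1\<bar> < \<delta>")
        case True
        have "p * (?A - \<epsilon>) \<le> p * (g (f (- \<delta> - x) - f \<delta> - \<delta>) - \<delta>)"
          using \<delta> p by (intro mult_left_mono) auto
        with objective_near[OF p, of s \<delta> \<theta>1 x] True show ?thesis by linarith
      next
        case False
        \<comment> \<open>One of the two gaps reaches its own bound, and the other is
          nonnegative.\<close>
        then have "m \<le> (g (f s + \<theta>1) - (f s + \<theta>1)) + (f s - s)"
          using m1(2)[of s] m2(2)[of "f s + \<theta>1"] F.ge_diagonal[of s] G.ge_diagonal[of "f s + \<theta>1"]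
          unfolding m_def by linarith
        from objective_far[OF p this] elim show ?thesis
          by (meson diff_gt_0_iff_gt less_le_trans less_imp_le)
      qed
    qed
  qed
qed

text \<open>Divided by \<open>p\<close>, the left-hand side tends to
  \<open>A - (A + \<epsilon>) = - \<epsilon>\<close>: the outcome \<open>x\<close> contributes
  \<open>A\<close>, and slope 1 at the origin turns the shift \<open>- p * (A + \<epsilon>)\<close>
  into \<open>- (A + \<epsilon>)\<close>.\<close>

lemma shortfall_feasible:
  assumes deriv: "((\<lambda>s. g (f s)) has_real_derivative 1) (at 0)" and "0 < \<epsilon>"
  shows "\<forall>\<^sub>F p in at_right 0. mean x p 0 (- (p * (g (f (- x)) + \<epsilon>))) \<le> 0"
proof -
  define A where "A = g (f (- x))"
  define B where "B = A + \<epsilon>"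
  have "((\<lambda>p. g (f (- (p * B)))) has_real_derivative 1 * (- B)) (at 0)"
    by (rule DERIV_chain2[where f = "\<lambda>s. g (f s)"])
      (use deriv in \<open>auto intro!: derivative_eq_intros\<close>)
  then have "((\<lambda>p. g (f (- (p * B))) / p) \<longlongrightarrow> - B) (at 0)"
    by (simp add: DERIV_def F.zero G.zero)
  then have d: "((\<lambda>p. g (f (- (p * B))) / p) \<longlongrightarrow> - B) (at_right 0)"
    by (rule filterlim_mono[OF _ order.refl at_le]) simp
  have "isCont (\<lambda>p. g (f (- (p * B) - x))) 0"
    by (intro continuous_intros isCont_o2[OF _ G.isCont] isCont_o2[OF _ F.isCont])
  then have c: "((\<lambda>p. g (f (- (p * B) - x))) \<longlongrightarrow> A) (at_right 0)"
    by (auto simp: isCont_def A_def intro: filterlim_mono[OF _ order.refl at_le])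
  have "((\<lambda>p. g (f (- (p * B) - x)) + (1 - p) * (g (f (- (p * B))) / p)) \<longlongrightarrow> A + (1 - 0) * (- B))
      (at_right 0)"
    by (intro tendsto_intros c d)
  then have "\<forall>\<^sub>F p in at_right 0. g (f (- (p * B) - x)) + (1 - p) * (g (f (- (p * B))) / p) < 0"
    by (rule order_tendstoD) (use assms in \<open>simp add: B_def\<close>)
  with eventually_at_right_less[of "0::real"]
  have "\<forall>\<^sub>F p in at_right 0. mean x p 0 (- (p * B)) \<le> 0"
  proof eventually_elim
    case (elim p)
    then have "p * (g (f (- (p * B) - x)) + (1 - p) * (g (f (- (p * B))) / p)) \<le> 0"
      by (intro mult_nonneg_nonpos) auto
    then show ?case
      using elim by (simp add: mean_def distrib_left)
  qed
  then show ?thesis by (simp add: A_def B_def)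
qed

end

section \<open>From the estimates to the two limits\<close>

theorem proposition4:
  fixes \<phi>1 \<phi>2 :: "real \<Rightarrow> ereal"
    and M :: "'a measure"
    and x :: real
    and X :: "real \<Rightarrow> 'a \<Rightarrow> real"
  assumes "\<phi>1 \<in> Phi0" and "\<phi>2 \<in> Phi0"
    and "lower_semicontinuous \<phi>1" and "lower_semicontinuous \<phi>2"
    and "eff_dom (\<lambda>s. conv_conj \<phi>1 (ereal s)) = UNIV"
    and "eff_dom (\<lambda>s. conv_conj \<phi>2 (ereal s)) = UNIV"
    and "\<And>s::real. s \<noteq> 0 \<Longrightarrow> conv_conj \<phi>1 (ereal s) > ereal s"
    and "\<And>s::real. s \<noteq> 0 \<Longrightarrow> conv_conj \<phi>2 (ereal s) > ereal s"
    and "prob_space M"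
    and "\<And>p. p \<in> {0<..<1} \<Longrightarrow> X p \<in> borel_measurable M"
    and "\<And>p. p \<in> {0<..<1} \<Longrightarrow>
           distr M borel (X p) =
           distr (measure_pmf (bernoulli_pmf p)) borel (\<lambda>b. if b then x else 0)"
  shows "((\<lambda>p. rho_oce \<phi>1 \<phi>2 M (X p) / ereal p) \<longlongrightarrow>
            conv_conj \<phi>2 (conv_conj \<phi>1 (ereal (- x)))) (at_right 0) \<and>
         (((\<lambda>s. real_of_ereal (conv_conj \<phi>2 (conv_conj \<phi>1 (ereal s))))
              has_real_derivative 1) (at 0) \<longrightarrow>
          ((\<lambda>p. rho_sf \<phi>1 \<phi>2 M (X p) / ereal p) \<longlongrightarrow>
            conv_conj \<phi>2 (conv_conj \<phi>1 (ereal (- x)))) (at_right 0))"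
proof -
  obtain f where f: "conjugate_like f" "\<And>s. conv_conj \<phi>1 (ereal s) = ereal (f s)"
    using conjugate_like_conv_conj[of \<phi>1] assms(1,5,7) by blast
  obtain g where g: "conjugate_like g" "\<And>s. conv_conj \<phi>2 (ereal s) = ereal (g s)"
    using conjugate_like_conv_conj[of \<phi>2] assms(2,6,8) by blast
  interpret conjugate_pair f g
    using f(1) g(1) by (rule conjugate_pair.intro)
  have expectation: "ereal_expectation M
        (\<lambda>\<omega>. conv_conj \<phi>2 (conv_conj \<phi>1 (ereal (s - X p \<omega>)) + ereal \<theta>1)) = ereal (mean x p \<theta>1 s)"
    if p: "p \<in> {0<..<1}" for p \<theta>1 s
  proof -
    have "continuous_on UNIV (\<lambda>y. g (f (s - y) + \<theta>1))"
      by (intro continuous_intros continuous_on_compose2[OF F.continuous]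
          continuous_on_compose2[OF G.continuous]) auto
    then have "(\<lambda>y. g (f (s - y) + \<theta>1)) \<in> borel_measurable borel"
      by (rule borel_measurable_continuous_onI)
    from ereal_expectation_two_point[OF p this assms(10)[OF p] assms(11)[OF p]]
    show ?thesis by (simp add: f(2) g(2) mean_def)
  qed
  have oce: "rho_oce \<phi>1 \<phi>2 M (X p) = Inf {ereal (- \<theta>1 - s + mean x p \<theta>1 s) | \<theta>1 s. True}"
    if "p \<in> {0<..<1}" for p
    unfolding rho_oce_def expectation[OF that] by simp
  have sf: "rho_sf \<phi>1 \<phi>2 M (X p) = Inf {ereal \<theta>2 | \<theta>1 \<theta>2. mean x p \<theta>1 (- \<theta>2) \<le> \<theta>1}"
    if "p \<in> {0<..<1}" for p
    unfolding rho_sf_def expectation[OF that] by simp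
  have in01: "\<forall>\<^sub>F p in at_right (0::real). p \<in> {0<..<1}"
    by (rule eventually_at_right_real) simp
  let ?A = "g (f (- x))"
  have "((\<lambda>p. rho_oce \<phi>1 \<phi>2 M (X p) / ereal p) \<longlongrightarrow> ereal ?A) (at_right 0)"
  proof (rule tendsto_ereal_divide_at_right_0I)
    fix \<epsilon> :: real assume \<epsilon>: "0 < \<epsilon>"
    show "\<forall>\<^sub>F p in at_right 0. ereal (p * (?A - \<epsilon>)) \<le> rho_oce \<phi>1 \<phi>2 M (X p)"
      using in01 objective_lower_bound[OF \<epsilon>, of x]
      by eventually_elim (auto simp: oce intro!: Inf_greatest)
    show "\<forall>\<^sub>F p in at_right 0. rho_oce \<phi>1 \<phi>2 M (X p) \<le> ereal (p * (?A + \<epsilon>))"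
      using in01
    proof eventually_elim
      case (elim p)
      have "rho_oce \<phi>1 \<phi>2 M (X p) \<le> ereal (- 0 - 0 + mean x p 0 0)"
        unfolding oce[OF elim] by (rule Inf_lower) blast
      also have "\<dots> \<le> ereal (p * (?A + \<epsilon>))"
        using elim \<epsilon> by (simp add: mean_def F.zero G.zero)
      finally show ?case .
    qed
  qed
  moreover have "((\<lambda>p. rho_sf \<phi>1 \<phi>2 M (X p) / ereal p) \<longlongrightarrow> ereal ?A) (at_right 0)"
    if deriv: "((\<lambda>s. g (f s)) has_real_derivative 1) (at 0)"
  proof (rule tendsto_ereal_divide_at_right_0I)
    fix \<epsilon> :: real assume \<epsilon>: "0 < \<epsilon>"
    show "\<forall>\<^sub>F p in at_right 0. ereal (p * (?A - \<epsilon>)) \<le> rho_sf \<phi>1 \<phi>2 M (X p)"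
      using in01 objective_lower_bound[OF \<epsilon>, of x]
    proof eventually_elim
      case (elim p)
      \<comment> \<open>The constraint bounds the OCE objective
        \<open>- \<theta>1 + \<theta>2 + mean x p \<theta>1 (- \<theta>2)\<close> by
        \<theta>2.\<close>
      have "p * (?A - \<epsilon>) \<le> \<theta>2" if "mean x p \<theta>1 (- \<theta>2) \<le> \<theta>1" for \<theta>1 \<theta>2
        using elim(2)[rule_format, of \<theta>1 "- \<theta>2"] that by linarith
      then show ?case
        unfolding sf[OF elim(1)] by (auto intro!: Inf_greatest)
    qed
    show "\<forall>\<^sub>F p in at_right 0. rho_sf \<phi>1 \<phi>2 M (X p) \<le> ereal (p * (?A + \<epsilon>))"
      using in01 shortfall_feasible[OF deriv \<epsilon>, of x]
    proof eventually_elim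
      case (elim p)
      then show ?case
        unfolding sf[OF elim(1)] by (intro Inf_lower) blast
    qed
  qed
  ultimately show ?thesis
    by (simp add: f(2) g(2))
qed

end
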